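(* Let $(N,\rho,\delta)$ be a Yetter-Drinfel'd module over a rank $2$ braided system $(C,A;\sigma_{C,C},\sigma_{A,A},\sigma_{C,A})$ in a strict monoidal category $\mathcal C$. Suppose that this system can be enriched into a rank $3$ braided system $(C,M,A)$ with the additional braiding components $\sigma_{C,M},\sigma_{M,M},\sigma_{M,A}$ (the components on $C$ and $A$ being the given ones). Then $N\otimes M$, endowed with $$\delta'=(N\otimes\sigma_{C,M})\circ(\delta\otimes M),\qquad \rho'=(\rho\otimes M)\circ(N\otimes\sigma_{M,A}),$$ is a Yetter-Drinfel'd module over $(C,A;\sigma_{C,C},\sigma_{A,A},\sigma_{C,A})$.
   Context: An object's name also denotes its identity morphism. A rank $r$ braided system is an ordered family $V_1,\dots,V_r$ with morphisms $\sigma_{i,j}\colon V_i\otimes V_j\to V_j\otimes V_i$, $1\le i\le j\le r$ (not necessarily invertible), satisfying for all $i\le j\le k$: $(\sigma_{j,k}\otimes V_i)\circ(V_j\otimes\sigma_{i,k})\circ(\sigma_{i,j}\otimes V_k)=(V_k\otimes\sigma_{i,j})\circ(\sigma_{i,k}\otimes V_j)\circ(V_i\otimes\sigma_{j,k})$. A Yetter-Drinfel'd module over $(C,A;\sigma_{C,C},\sigma_{A,A},\sigma_{C,A})$ is an object $N$ with $\rho\colon N\otimes A\to N$ and $\delta\colon N\to N\otimes C$ such that $\rho(\rho\otimes A)=\rho(\rho\otimes A)(N\otimes\sigma_{A,A})$, $(\delta\otimes C)\delta=(N\otimes\sigma_{C,C})(\delta\otimes C)\delta$ and $\delta\rho=(\rho\otimes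 C)(N\otimes\sigma_{C,A})(\delta\otimes A)$. *)

theory Defs
  imports Main
begin

text \<open>
  Strict monoidal categories with an explicit carrier of objects and of morphisms.
  As a strict tensor product is associative on the nose, no coherence isomorphisms occur;
  composition and tensor are only constrained on (composable) morphisms of the category.
\<close>

record ('o, 'm) mon_cat =
  obj :: "'o set"
  arr :: "'m set"
  dom :: "'m \<Rightarrow> 'o"
  cod :: "'m \<Rightarrow> 'o"
  idm :: "'o \<Rightarrow> 'm" (\<open>\<one>\<index>\<close>)
  comp :: "'m \<Rightarrow> 'm \<Rightarrow> 'm" (infixr \<open>\<cdot>\<index>\<close> 60)
  unit :: 'o (\<open>\<I>\<index>\<close>)
  otensor :: "'o \<Rightarrow> 'o \<Rightarrow> 'o" (infixl \<open>\<odot>\<index>\<close> 70)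
  tensor :: "'m \<Rightarrow> 'm \<Rightarrow> 'm" (infixl \<open>\<otimes>\<index>\<close> 70)

definition hom :: "('o, 'm, 'x) mon_cat_scheme \<Rightarrow> 'o \<Rightarrow> 'o \<Rightarrow> 'm set"
  where "hom \<C> X Y = {f \<in> arr \<C>. dom \<C> f = X \<and> cod \<C> f = Y}"

locale strict_monoidal_category =
  fixes \<C> :: "('o, 'm, 'x) mon_cat_scheme" (structure)
  assumes dom_obj: "f \<in> arr \<C> \<Longrightarrow> dom \<C> f \<in> obj \<C>"
    and cod_obj: "f \<in> arr \<C> \<Longrightarrow> cod \<C> f \<in> obj \<C>"
    and id_hom: "X \<in> obj \<C> \<Longrightarrow> \<one> X \<in> hom \<C> X X"
    and comp_hom: "\<lbrakk>f \<in> hom \<C> X Y; g \<in> hom \<C> Y Z\<rbrakk> \<Longrightarrow> g \<cdot> f \<in> hom \<C> X Z"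
    and comp_id_right: "f \<in> hom \<C> X Y \<Longrightarrow> f \<cdot> \<one> X = f"
    and comp_id_left: "f \<in> hom \<C> X Y \<Longrightarrow> \<one> Y \<cdot> f = f"
    and comp_assoc:
      "\<lbrakk>f \<in> hom \<C> W X; g \<in> hom \<C> X Y; h \<in> hom \<C> Y Z\<rbrakk> \<Longrightarrow> (h \<cdot> g) \<cdot> f = h \<cdot> (g \<cdot> f)"
    and unit_obj: "\<I> \<in> obj \<C>"
    and otensor_obj: "\<lbrakk>X \<in> obj \<C>; Y \<in> obj \<C>\<rbrakk> \<Longrightarrow> X \<odot> Y \<in> obj \<C>"
    and otensor_assoc:
      "\<lbrakk>X \<in> obj \<C>; Y \<in> obj \<C>; Z \<in> obj \<C>\<rbrakk> \<Longrightarrow> (X \<odot> Y) \<odot> Z = X \<odot> (Y \<odot> Z)"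
    and otensor_unit_left: "X \<in> obj \<C> \<Longrightarrow> \<I> \<odot> X = X"
    and otensor_unit_right: "X \<in> obj \<C> \<Longrightarrow> X \<odot> \<I> = X"
    and tensor_hom:
      "\<lbrakk>f \<in> hom \<C> X Y; g \<in> hom \<C> X' Y'\<rbrakk> \<Longrightarrow> f \<otimes> g \<in> hom \<C> (X \<odot> X') (Y \<odot> Y')"
    and tensor_id: "\<lbrakk>X \<in> obj \<C>; Y \<in> obj \<C>\<rbrakk> \<Longrightarrow> \<one> X \<otimes> \<one> Y = \<one> (X \<odot> Y)"
    and interchange:
      "\<lbrakk>f \<in> hom \<C> X Y; g \<in> hom \<C> Y Z; f' \<in> hom \<C> X' Y'; g' \<in> hom \<C> Y' Z'\<rbrakk>
        \<Longrightarrow> (g \<otimes> g') \<cdot> (f \<otimes> f') = (g \<cdot> f) \<otimes> (g' \<cdot> f')"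
    and tensor_assoc:
      "\<lbrakk>f \<in> arr \<C>; g \<in> arr \<C>; h \<in> arr \<C>\<rbrakk> \<Longrightarrow> (f \<otimes> g) \<otimes> h = f \<otimes> (g \<otimes> h)"
    and tensor_unit_left: "f \<in> arr \<C> \<Longrightarrow> \<one> \<I> \<otimes> f = f"
    and tensor_unit_right: "f \<in> arr \<C> \<Longrightarrow> f \<otimes> \<one> \<I> = f"

text \<open>
  Only the values \<open>V i\<close> for \<open>1 \<le> i \<le> r\<close> and \<open>\<sigma> i j\<close> for \<open>1 \<le> i \<le> j \<le> r\<close> matter.
\<close>

locale braided_system = strict_monoidal_category \<C>
  for \<C> :: "('o, 'm, 'x) mon_cat_scheme" (structure) +
  fixes r :: nat
    and V :: "nat \<Rightarrow> 'o"
    and \<sigma> :: "nat \<Rightarrow> nat \<Rightarrow> 'm"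
  assumes V_obj: "\<lbrakk>1 \<le> i; i \<le> r\<rbrakk> \<Longrightarrow> V i \<in> obj \<C>"
    and braiding_hom:
      "\<lbrakk>1 \<le> i; i \<le> j; j \<le> r\<rbrakk> \<Longrightarrow> \<sigma> i j \<in> hom \<C> (V i \<odot> V j) (V j \<odot> V i)"
    and yang_baxter:
      "\<lbrakk>1 \<le> i; i \<le> j; j \<le> k; k \<le> r\<rbrakk> \<Longrightarrow>
        (\<sigma> j k \<otimes> \<one> (V i)) \<cdot> (\<one> (V j) \<otimes> \<sigma> i k) \<cdot> (\<sigma> i j \<otimes> \<one> (V k)) =
        (\<one> (V k) \<otimes> \<sigma> i j) \<cdot> (\<sigma> i k \<otimes> \<one> (V j)) \<cdot> (\<one> (V i) \<otimes> \<sigma> j k)"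

definition family2 :: "'o \<Rightarrow> 'o \<Rightarrow> nat \<Rightarrow> 'o"
  where "family2 X Y i = (if i = 1 then X else Y)"

definition braiding2 :: "'m \<Rightarrow> 'm \<Rightarrow> 'm \<Rightarrow> nat \<Rightarrow> nat \<Rightarrow> 'm"
  where "braiding2 \<sigma>11 \<sigma>22 \<sigma>12 i j =
    (if (i, j) = (1, 1) then \<sigma>11 else if (i, j) = (2, 2) then \<sigma>22 else \<sigma>12)"

definition family3 :: "'o \<Rightarrow> 'o \<Rightarrow> 'o \<Rightarrow> nat \<Rightarrow> 'o"
  where "family3 X Y Z i = (if i = 1 then X else if i = 2 then Y else Z)"

definition braiding3 ::
    "'m \<Rightarrow> 'm \<Rightarrow> 'm \<Rightarrow> 'm \<Rightarrow> 'm \<Rightarrow> 'm \<Rightarrow> nat \<Rightarrow> nat \<Rightarrow> 'm"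
  where "braiding3 \<sigma>11 \<sigma>22 \<sigma>33 \<sigma>12 \<sigma>13 \<sigma>23 i j =
    (if (i, j) = (1, 1) then \<sigma>11 else if (i, j) = (2, 2) then \<sigma>22
     else if (i, j) = (3, 3) then \<sigma>33 else if (i, j) = (1, 2) then \<sigma>12
     else if (i, j) = (1, 3) then \<sigma>13 else \<sigma>23)"

locale yetter_drinfeld_module =
  braided_system \<C> 2 "family2 C A" "braiding2 \<sigma>CC \<sigma>AA \<sigma>CA"
  for \<C> :: "('o, 'm, 'x) mon_cat_scheme" (structure)
    and C A :: 'o
    and \<sigma>CC \<sigma>AA \<sigma>CA :: 'm +
  fixes N :: 'o
    and \<rho> \<delta> :: 'm
  assumes N_obj: "N \<in> obj \<C>"
    and action_hom: "\<rho> \<in> hom \<C> (N \<odot> A) N"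
    and coaction_hom: "\<delta> \<in> hom \<C> N (N \<odot> C)"
    and braided_action:
      "\<rho> \<cdot> (\<rho> \<otimes> \<one> A) = \<rho> \<cdot> (\<rho> \<otimes> \<one> A) \<cdot> (\<one> N \<otimes> \<sigma>AA)"
    and braided_coaction:
      "(\<delta> \<otimes> \<one> C) \<cdot> \<delta> = (\<one> N \<otimes> \<sigma>CC) \<cdot> (\<delta> \<otimes> \<one> C) \<cdot> \<delta>"
    and yetter_drinfeld:
      "\<delta> \<cdot> \<rho> = (\<rho> \<otimes> \<one> C) \<cdot> (\<one> N \<otimes> \<sigma>CA) \<cdot> (\<delta> \<otimes> \<one> A)"

end

theory Submission
  imports Defs
begin

text \<open>
  Read composites as string diagrams from bottom to top. In \<open>\<rho>'\<close> the strand \<open>A\<close> crosses \<open>M\<close>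
  and then acts on \<open>N\<close>; in \<open>\<delta>'\<close> the strand \<open>C\<close> emitted by \<open>N\<close> crosses \<open>M\<close>. All three axioms
  for \<open>N \<odot> M\<close> follow from the same three moves. By bifunctoriality \<open>\<rho>\<close> slides up and \<open>\<delta>\<close> slides down past
  the crossings that they do not touch, which gathers the operations of \<open>N\<close> at the ends and
  leaves two crossings with \<open>M\<close> in the middle. The axiom for \<open>N\<close>, with \<open>M\<close> as a spectator,
  supplies a crossing \<open>\<sigma>AA\<close>, \<open>\<sigma>CC\<close> or \<open>\<sigma>CA\<close> on one side of the strand \<open>M\<close>, and a Yang--Baxter
  equation moves it to the other side: that for \<open>(M, A, A)\<close> in \<open>braided_action_tensor\<close>,
  for \<open>(C, C, M)\<close> in \<open>braided_coaction_tensor\<close> and for \<open>(C, M, A)\<close> in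
  \<open>yetter_drinfeld_tensor\<close>.
\<close>

section \<open>Diagram calculus in strict monoidal categories\<close>

context strict_monoidal_category
begin

text \<open>
  Splitting \<^const>\<open>hom\<close> into its three components lets the simplifier type composites: the
  intermediate object of a composition is then computed rather than guessed.
\<close>

lemma arr_comp: "\<lbrakk>f \<in> arr \<C>; g \<in> arr \<C>; cod \<C> f = dom \<C> g\<rbrakk> \<Longrightarrow> g \<cdot> f \<in> arr \<C>"
  and dom_comp: "\<lbrakk>f \<in> arr \<C>; g \<in> arr \<C>; cod \<C> f = dom \<C> g\<rbrakk> \<Longrightarrow> dom \<C> (g \<cdot> f) = dom \<C> f"
  and cod_comp: "\<lbrakk>f \<in> arr \<C>; g \<in> arr \<C>; cod \<C> f = dom \<C> g\<rbrakk> \<Longrightarrow> cod \<C> (g \<cdot> f) = cod \<C> g"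
  using comp_hom[of f "dom \<C> f" "cod \<C> f" g "cod \<C> g"] by (auto simp: hom_def)

lemma arr_tensor: "\<lbrakk>f \<in> arr \<C>; g \<in> arr \<C>\<rbrakk> \<Longrightarrow> f \<otimes> g \<in> arr \<C>"
  and dom_tensor: "\<lbrakk>f \<in> arr \<C>; g \<in> arr \<C>\<rbrakk> \<Longrightarrow> dom \<C> (f \<otimes> g) = dom \<C> f \<odot> dom \<C> g"
  and cod_tensor: "\<lbrakk>f \<in> arr \<C>; g \<in> arr \<C>\<rbrakk> \<Longrightarrow> cod \<C> (f \<otimes> g) = cod \<C> f \<odot> cod \<C> g"
  using tensor_hom[of f "dom \<C> f" "cod \<C> f" g "dom \<C> g" "cod \<C> g"] by (auto simp: hom_def)

lemma arr_id: "X \<in> obj \<C> \<Longrightarrow> \<one> X \<in> arr \<C>"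
  and dom_id: "X \<in> obj \<C> \<Longrightarrow> dom \<C> (\<one> X) = X"
  and cod_id: "X \<in> obj \<C> \<Longrightarrow> cod \<C> (\<one> X) = X"
  using id_hom[of X] by (auto simp: hom_def)

lemmas typing = arr_comp dom_comp cod_comp arr_tensor dom_tensor cod_tensor
  arr_id dom_id cod_id dom_obj cod_obj otensor_obj otensor_assoc

lemma comp_assoc_arr:
  "\<lbrakk>f \<in> arr \<C>; g \<in> arr \<C>; h \<in> arr \<C>; cod \<C> f = dom \<C> g; cod \<C> g = dom \<C> h\<rbrakk>
    \<Longrightarrow> (h \<cdot> g) \<cdot> f = h \<cdot> g \<cdot> f"
  by (rule comp_assoc) (auto simp: hom_def)

lemma whisker_right_comp:
  assumes "f \<in> arr \<C>" "g \<in> arr \<C>" "cod \<C> f = dom \<C> g" "X \<in> obj \<C>"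
  shows "(g \<cdot> f) \<otimes> \<one> X = (g \<otimes> \<one> X) \<cdot> (f \<otimes> \<one> X)"
  using assms interchange[of f "dom \<C> f" "cod \<C> f" g "cod \<C> g" "\<one> X" X X "\<one> X" X]
    comp_id_left[of "\<one> X" X X] by (simp add: hom_def typing)

lemma whisker_left_comp:
  assumes "f \<in> arr \<C>" "g \<in> arr \<C>" "cod \<C> f = dom \<C> g" "X \<in> obj \<C>"
  shows "\<one> X \<otimes> (g \<cdot> f) = (\<one> X \<otimes> g) \<cdot> (\<one> X \<otimes> f)"
  using assms interchange[of "\<one> X" X X "\<one> X" X f "dom \<C> f" "cod \<C> f" g "cod \<C> g"]
    comp_id_left[of "\<one> X" X X] by (simp add: hom_def typing)

lemma whisker_left_twice:
  "\<lbrakk>X \<in> obj \<C>; Y \<in> obj \<C>; f \<in> arr \<C>\<rbrakk> \<Longrightarrow> \<one> X \<otimes> (\<one> Y \<otimes> f) = \<one> (X \<odot> Y) \<otimes> f"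
  by (simp add: tensor_assoc[symmetric] tensor_id typing)

text \<open>
  For a diagram given as a composite of whiskered generators, rewriting with these rules yields
  a right-nested composite of layers \<open>\<one> X \<otimes> (f \<otimes> \<one> Y)\<close> with a single generator \<open>f\<close> each.
  Two diagrams with the same layers in the same order are then equal by simplification, and
  only slides and relations between generators need an explicit step.
\<close>

lemmas layers = comp_assoc_arr whisker_right_comp whisker_left_comp
  tensor_assoc tensor_id whisker_left_twice typing

text \<open>
  Both sides equal \<open>f \<otimes> g\<close>, by the interchange law.
\<close>

lemma slide:
  assumes "f \<in> arr \<C>" "g \<in> arr \<C>"
  shows "(\<one> (cod \<C> f) \<otimes> g) \<cdot> (f \<otimes> \<one> (dom \<C> g)) = (f \<otimes> \<one> (cod \<C> g)) \<cdot> (\<one> (dom \<C> f) \<otimes> g)"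
proof -
  have "(\<one> (cod \<C> f) \<otimes> g) \<cdot> (f \<otimes> \<one> (dom \<C> g)) = f \<otimes> g"
    using assms interchange[of f "dom \<C> f" "cod \<C> f" "\<one> (cod \<C> f)" "cod \<C> f"
        "\<one> (dom \<C> g)" "dom \<C> g" "dom \<C> g" g "cod \<C> g"]
      comp_id_left[of f] comp_id_right[of g] by (simp add: hom_def typing)
  also have "\<dots> = (f \<otimes> \<one> (cod \<C> g)) \<cdot> (\<one> (dom \<C> f) \<otimes> g)"
    using assms interchange[of "\<one> (dom \<C> f)" "dom \<C> f" "dom \<C> f" f "cod \<C> f"
        g "dom \<C> g" "cod \<C> g" "\<one> (cod \<C> g)" "cod \<C> g"]
      comp_id_left[of g] comp_id_right[of f] by (simp add: hom_def typing)
  finally show ?thesis .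
qed

text \<open>
  In a right-nested composite the two outermost layers are not a subterm, so an equation between
  two-layer composites cannot rewrite them directly.
\<close>

lemma replace_top_two:
  assumes "g \<cdot> f = g' \<cdot> f'"
    and "f \<in> arr \<C>" "g \<in> arr \<C>" "cod \<C> f = dom \<C> g"
    and "f' \<in> arr \<C>" "g' \<in> arr \<C>" "cod \<C> f' = dom \<C> g'"
    and "k \<in> arr \<C>" "cod \<C> k = dom \<C> f" "cod \<C> k = dom \<C> f'"
  shows "g \<cdot> f \<cdot> k = g' \<cdot> f' \<cdot> k"
  using assms by (metis comp_assoc_arr)

section \<open>The Yetter--Drinfeld axioms for the tensor product\<close>

text \<open>
  Sliding the first action up past the second crossing puts both actions on top of two
  crossings of \<open>M\<close> with \<open>A\<close>. The two actions absorb \<open>\<sigma>AA\<close> placed between them and these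
  crossings, and \<open>yb\<close> carries it below the crossings.
\<close>

lemma braided_action_tensor:
  assumes "N \<in> obj \<C>" "M \<in> obj \<C>" "A \<in> obj \<C>"
    and "\<rho> \<in> hom \<C> (N \<odot> A) N" "\<sigma>AA \<in> hom \<C> (A \<odot> A) (A \<odot> A)"
    and "\<sigma>MA \<in> hom \<C> (M \<odot> A) (A \<odot> M)"
    and action: "\<rho> \<cdot> (\<rho> \<otimes> \<one> A) = \<rho> \<cdot> (\<rho> \<otimes> \<one> A) \<cdot> (\<one> N \<otimes> \<sigma>AA)"
    and yb: "(\<sigma>AA \<otimes> \<one> M) \<cdot> (\<one> A \<otimes> \<sigma>MA) \<cdot> (\<sigma>MA \<otimes> \<one> A) =
      (\<one> A \<otimes> \<sigma>MA) \<cdot> (\<sigma>MA \<otimes> \<one> A) \<cdot> (\<one> M \<otimes> \<sigma>AA)"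
    and \<rho>': "\<rho>' = (\<rho> \<otimes> \<one> M) \<cdot> (\<one> N \<otimes> \<sigma>MA)"
  shows "\<rho>' \<cdot> (\<rho>' \<otimes> \<one> A) = \<rho>' \<cdot> (\<rho>' \<otimes> \<one> A) \<cdot> (\<one> (N \<odot> M) \<otimes> \<sigma>AA)"
proof -
  note types = assms(1-6)[unfolded hom_def, simplified]
  let ?\<rho>\<rho> = "(\<rho> \<otimes> \<one> M) \<cdot> (\<rho> \<otimes> \<one> (A \<odot> M))"
  let ?x = "(\<one> (N \<odot> A) \<otimes> \<sigma>MA) \<cdot> (\<one> N \<otimes> (\<sigma>MA \<otimes> \<one> A))"
  have slide_\<rho>: "(\<one> N \<otimes> \<sigma>MA) \<cdot> (\<rho> \<otimes> \<one> (M \<odot> A)) =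
      (\<rho> \<otimes> \<one> (A \<odot> M)) \<cdot> (\<one> (N \<odot> A) \<otimes> \<sigma>MA)"
    using slide[of \<rho> \<sigma>MA] types by simp
  have normal: "\<rho>' \<cdot> (\<rho>' \<otimes> \<one> A) = ?\<rho>\<rho> \<cdot> ?x"
    using types replace_top_two[OF slide_\<rho>, of "\<one> N \<otimes> (\<sigma>MA \<otimes> \<one> A)"]
    by (simp add: \<rho>' layers)
  have action_M: "?\<rho>\<rho> = ?\<rho>\<rho> \<cdot> (\<one> N \<otimes> (\<sigma>AA \<otimes> \<one> M))"
  proof -
    have "?\<rho>\<rho> = (\<rho> \<cdot> (\<rho> \<otimes> \<one> A)) \<otimes> \<one> M"
      using types by (simp add: layers)
    also have "\<dots> = (\<rho> \<cdot> (\<rho> \<otimes> \<one> A) \<cdot> (\<one> N \<otimes> \<sigma>AA)) \<otimes> \<one> M"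
      by (simp only: action[symmetric])
    also have "\<dots> = ?\<rho>\<rho> \<cdot> (\<one> N \<otimes> (\<sigma>AA \<otimes> \<one> M))"
      using types by (simp add: layers)
    finally show ?thesis .
  qed
  have yb_N: "(\<one> N \<otimes> (\<sigma>AA \<otimes> \<one> M)) \<cdot> ?x = ?x \<cdot> (\<one> (N \<odot> M) \<otimes> \<sigma>AA)"
    using arg_cong[OF yb, of "\<lambda>f. \<one> N \<otimes> f"] types by (simp add: layers)
  have "\<rho>' \<cdot> (\<rho>' \<otimes> \<one> A) = (?\<rho>\<rho> \<cdot> (\<one> N \<otimes> (\<sigma>AA \<otimes> \<one> M))) \<cdot> ?x"
    by (subst action_M[symmetric]) (rule normal)
  also have "\<dots> = ?\<rho>\<rho> \<cdot> (\<one> N \<otimes> (\<sigma>AA \<otimes> \<one> M)) \<cdot> ?x"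
    using types by (simp add: layers)
  also have "\<dots> = ?\<rho>\<rho> \<cdot> ?x \<cdot> (\<one> (N \<odot> M) \<otimes> \<sigma>AA)"
    by (simp only: yb_N)
  also have "\<dots> = (?\<rho>\<rho> \<cdot> ?x) \<cdot> (\<one> (N \<odot> M) \<otimes> \<sigma>AA)"
    using types by (simp add: layers)
  also have "\<dots> = (\<rho>' \<cdot> (\<rho>' \<otimes> \<one> A)) \<cdot> (\<one> (N \<odot> M) \<otimes> \<sigma>AA)"
    by (simp only: normal)
  also have "\<dots> = \<rho>' \<cdot> (\<rho>' \<otimes> \<one> A) \<cdot> (\<one> (N \<odot> M) \<otimes> \<sigma>AA)"
    using types by (simp add: \<rho>' layers)
  finally show ?thesis .
qed

text \<open>
  The upside-down picture: both coactions move to the bottom and absorb \<open>\<sigma>CC\<close> placed just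
  above them, which \<open>yb\<close> carries above the two crossings of \<open>C\<close> with \<open>M\<close>.
\<close>

lemma braided_coaction_tensor:
  assumes "N \<in> obj \<C>" "M \<in> obj \<C>" "C \<in> obj \<C>"
    and "\<delta> \<in> hom \<C> N (N \<odot> C)" "\<sigma>CC \<in> hom \<C> (C \<odot> C) (C \<odot> C)"
    and "\<sigma>CM \<in> hom \<C> (C \<odot> M) (M \<odot> C)"
    and coaction: "(\<delta> \<otimes> \<one> C) \<cdot> \<delta> = (\<one> N \<otimes> \<sigma>CC) \<cdot> (\<delta> \<otimes> \<one> C) \<cdot> \<delta>"
    and yb: "(\<sigma>CM \<otimes> \<one> C) \<cdot> (\<one> C \<otimes> \<sigma>CM) \<cdot> (\<sigma>CC \<otimes> \<one> M) =
      (\<one> M \<otimes> \<sigma>CC) \<cdot> (\<sigma>CM \<otimes> \<one> C) \<cdot> (\<one> C \<otimes> \<sigma>CM)"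
    and \<delta>': "\<delta>' = (\<one> N \<otimes> \<sigma>CM) \<cdot> (\<delta> \<otimes> \<one> M)"
  shows "(\<delta>' \<otimes> \<one> C) \<cdot> \<delta>' = (\<one> (N \<odot> M) \<otimes> \<sigma>CC) \<cdot> (\<delta>' \<otimes> \<one> C) \<cdot> \<delta>'"
proof -
  note types = assms(1-6)[unfolded hom_def, simplified]
  let ?\<delta>\<delta> = "(\<delta> \<otimes> \<one> (C \<odot> M)) \<cdot> (\<delta> \<otimes> \<one> M)"
  let ?x = "(\<one> N \<otimes> (\<sigma>CM \<otimes> \<one> C)) \<cdot> (\<one> (N \<odot> C) \<otimes> \<sigma>CM)"
  have slide_\<delta>: "(\<delta> \<otimes> \<one> (M \<odot> C)) \<cdot> (\<one> N \<otimes> \<sigma>CM) =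
      (\<one> (N \<odot> C) \<otimes> \<sigma>CM) \<cdot> (\<delta> \<otimes> \<one> (C \<odot> M))"
    using slide[of \<delta> \<sigma>CM] types by simp
  have normal: "(\<delta>' \<otimes> \<one> C) \<cdot> \<delta>' = ?x \<cdot> ?\<delta>\<delta>"
    using types replace_top_two[OF slide_\<delta>, of "\<delta> \<otimes> \<one> M"]
    by (simp add: \<delta>' layers)
  have coaction_M: "?\<delta>\<delta> = (\<one> N \<otimes> (\<sigma>CC \<otimes> \<one> M)) \<cdot> ?\<delta>\<delta>"
  proof -
    have "?\<delta>\<delta> = ((\<delta> \<otimes> \<one> C) \<cdot> \<delta>) \<otimes> \<one> M"
      using types by (simp add: layers)
    also have "\<dots> = ((\<one> N \<otimes> \<sigma>CC) \<cdot> (\<delta> \<otimes> \<one> C) \<cdot> \<delta>) \<otimes> \<one> M"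
      by (simp only: coaction[symmetric])
    also have "\<dots> = (\<one> N \<otimes> (\<sigma>CC \<otimes> \<one> M)) \<cdot> ?\<delta>\<delta>"
      using types by (simp add: layers)
    finally show ?thesis .
  qed
  have yb_N: "?x \<cdot> (\<one> N \<otimes> (\<sigma>CC \<otimes> \<one> M)) = (\<one> (N \<odot> M) \<otimes> \<sigma>CC) \<cdot> ?x"
    using arg_cong[OF yb, of "\<lambda>f. \<one> N \<otimes> f"] types by (simp add: layers)
  have "(\<delta>' \<otimes> \<one> C) \<cdot> \<delta>' = ?x \<cdot> (\<one> N \<otimes> (\<sigma>CC \<otimes> \<one> M)) \<cdot> ?\<delta>\<delta>"
    by (subst coaction_M[symmetric]) (rule normal)
  also have "\<dots> = (?x \<cdot> (\<one> N \<otimes> (\<sigma>CC \<otimes> \<one> M))) \<cdot> ?\<delta>\<delta>"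
    using types by (simp add: layers)
  also have "\<dots> = ((\<one> (N \<odot> M) \<otimes> \<sigma>CC) \<cdot> ?x) \<cdot> ?\<delta>\<delta>"
    by (simp only: yb_N)
  also have "\<dots> = (\<one> (N \<odot> M) \<otimes> \<sigma>CC) \<cdot> ?x \<cdot> ?\<delta>\<delta>"
    using types by (simp add: layers)
  also have "\<dots> = (\<one> (N \<odot> M) \<otimes> \<sigma>CC) \<cdot> (\<delta>' \<otimes> \<one> C) \<cdot> \<delta>'"
    by (simp only: normal)
  finally show ?thesis .
qed

text \<open>
  In \<open>\<delta>' \<cdot> \<rho>'\<close> the action of \<open>N\<close> is directly followed by the coaction, so \<open>yd\<close> applies at
  once and creates a crossing \<open>\<sigma>CA\<close>. After the slides it lies between \<open>\<sigma>MA\<close> and \<open>\<sigma>CM\<close>, with \<open>M\<close> on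
  its right; \<open>yb\<close> moves \<open>M\<close> to its left, as the right-hand side requires.
\<close>

lemma yetter_drinfeld_tensor:
  assumes "N \<in> obj \<C>" "M \<in> obj \<C>" "A \<in> obj \<C>" "C \<in> obj \<C>"
    and "\<rho> \<in> hom \<C> (N \<odot> A) N" "\<delta> \<in> hom \<C> N (N \<odot> C)"
    and "\<sigma>CM \<in> hom \<C> (C \<odot> M) (M \<odot> C)" "\<sigma>MA \<in> hom \<C> (M \<odot> A) (A \<odot> M)"
    and "\<sigma>CA \<in> hom \<C> (C \<odot> A) (A \<odot> C)"
    and yd: "\<delta> \<cdot> \<rho> = (\<rho> \<otimes> \<one> C) \<cdot> (\<one> N \<otimes> \<sigma>CA) \<cdot> (\<delta> \<otimes> \<one> A)"
    and yb: "(\<sigma>MA \<otimes> \<one> C) \<cdot> (\<one> M \<otimes> \<sigma>CA) \<cdot> (\<sigma>CM \<otimes> \<one> A) =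
      (\<one> A \<otimes> \<sigma>CM) \<cdot> (\<sigma>CA \<otimes> \<one> M) \<cdot> (\<one> C \<otimes> \<sigma>MA)"
    and \<rho>': "\<rho>' = (\<rho> \<otimes> \<one> M) \<cdot> (\<one> N \<otimes> \<sigma>MA)"
    and \<delta>': "\<delta>' = (\<one> N \<otimes> \<sigma>CM) \<cdot> (\<delta> \<otimes> \<one> M)"
  shows "\<delta>' \<cdot> \<rho>' = (\<rho>' \<otimes> \<one> C) \<cdot> (\<one> (N \<odot> M) \<otimes> \<sigma>CA) \<cdot> (\<delta>' \<otimes> \<one> A)"
proof -
  note types = assms(1-9)[unfolded hom_def, simplified]
  let ?\<rho> = "\<rho> \<otimes> \<one> (M \<odot> C)" and ?\<delta> = "\<delta> \<otimes> \<one> (M \<odot> A)"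
  let ?ca = "\<one> N \<otimes> (\<sigma>CA \<otimes> \<one> M)"
  have slide_\<rho>: "(\<one> N \<otimes> \<sigma>CM) \<cdot> (\<rho> \<otimes> \<one> (C \<odot> M)) = ?\<rho> \<cdot> (\<one> (N \<odot> A) \<otimes> \<sigma>CM)"
    using slide[of \<rho> \<sigma>CM] types by simp
  have slide_\<delta>: "(\<delta> \<otimes> \<one> (A \<odot> M)) \<cdot> (\<one> N \<otimes> \<sigma>MA) = (\<one> (N \<odot> C) \<otimes> \<sigma>MA) \<cdot> ?\<delta>"
    using slide[of \<delta> \<sigma>MA] types by simp
  have yd_M: "(\<delta> \<otimes> \<one> M) \<cdot> (\<rho> \<otimes> \<one> M) = (\<rho> \<otimes> \<one> (C \<odot> M)) \<cdot> ?ca \<cdot> (\<delta> \<otimes> \<one> (A \<odot> M))"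
    using arg_cong[OF yd, of "\<lambda>f. f \<otimes> \<one> M"] types by (simp add: layers)
  have yb_N: "(\<one> (N \<odot> A) \<otimes> \<sigma>CM) \<cdot> ?ca \<cdot> (\<one> (N \<odot> C) \<otimes> \<sigma>MA) =
      (\<one> N \<otimes> (\<sigma>MA \<otimes> \<one> C)) \<cdot> (\<one> (N \<odot> M) \<otimes> \<sigma>CA) \<cdot> (\<one> N \<otimes> (\<sigma>CM \<otimes> \<one> A))"
    using arg_cong[OF yb, of "\<lambda>f. \<one> N \<otimes> f"] types by (simp add: layers)
  have "\<delta>' \<cdot> \<rho>' = (\<one> N \<otimes> \<sigma>CM) \<cdot> ((\<delta> \<otimes> \<one> M) \<cdot> (\<rho> \<otimes> \<one> M)) \<cdot> (\<one> N \<otimes> \<sigma>MA)"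
    using types by (simp add: \<rho>' \<delta>' layers)
  also have "\<dots> = ((\<one> N \<otimes> \<sigma>CM) \<cdot> (\<rho> \<otimes> \<one> (C \<odot> M))) \<cdot> ?ca \<cdot>
      ((\<delta> \<otimes> \<one> (A \<odot> M)) \<cdot> (\<one> N \<otimes> \<sigma>MA))"
    unfolding yd_M using types by (simp add: layers)
  also have "\<dots> = ?\<rho> \<cdot> ((\<one> (N \<odot> A) \<otimes> \<sigma>CM) \<cdot> ?ca \<cdot> (\<one> (N \<odot> C) \<otimes> \<sigma>MA)) \<cdot> ?\<delta>"
    unfolding slide_\<rho> slide_\<delta> using types by (simp add: layers)
  also have "\<dots> = (\<rho>' \<otimes> \<one> C) \<cdot> (\<one> (N \<odot> M) \<otimes> \<sigma>CA) \<cdot> (\<delta>' \<otimes> \<one> A)"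
    unfolding yb_N using types by (simp add: \<rho>' \<delta>' layers)
  finally show ?thesis .
qed

end

theorem proposition5p1:
  fixes \<C> :: "('o, 'm, 'x) mon_cat_scheme" (structure)
    and C A M N :: 'o
    and \<sigma>CC \<sigma>AA \<sigma>CA \<sigma>CM \<sigma>MM \<sigma>MA \<rho> \<delta> :: 'm
  assumes "strict_monoidal_category \<C>"
    and "braided_system \<C> 2 (family2 C A) (braiding2 \<sigma>CC \<sigma>AA \<sigma>CA)"
    and "yetter_drinfeld_module \<C> C A \<sigma>CC \<sigma>AA \<sigma>CA N \<rho> \<delta>"
    and "braided_system \<C> 3 (family3 C M A) (braiding3 \<sigma>CC \<sigma>MM \<sigma>AA \<sigma>CM \<sigma>CA \<sigma>MA)"
  shows "yetter_drinfeld_module \<C> C A \<sigma>CC \<sigma>AA \<sigma>CA (N \<odot> M)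
    ((\<rho> \<otimes> \<one> M) \<cdot> (\<one> N \<otimes> \<sigma>MA))
    ((\<one> N \<otimes> \<sigma>CM) \<cdot> (\<delta> \<otimes> \<one> M))"
proof -
  interpret yetter_drinfeld_module \<C> C A \<sigma>CC \<sigma>AA \<sigma>CA N \<rho> \<delta>
    by (rule assms(3))
  interpret CMA: braided_system \<C> 3 "family3 C M A"
    "braiding3 \<sigma>CC \<sigma>MM \<sigma>AA \<sigma>CM \<sigma>CA \<sigma>MA"
    by (rule assms(4))
  note comps = family3_def braiding3_def
  have objs: "C \<in> obj \<C>" "M \<in> obj \<C>" "A \<in> obj \<C>"
    using CMA.V_obj[of 1] CMA.V_obj[of 2] CMA.V_obj[of 3] by (simp_all add: comps)
  have homs: "\<sigma>CC \<in> hom \<C> (C \<odot> C) (C \<odot> C)" "\<sigma>AA \<in> hom \<C> (A \<odot> A) (A \<odot> A)"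
    "\<sigma>CM \<in> hom \<C> (C \<odot> M) (M \<odot> C)" "\<sigma>CA \<in> hom \<C> (C \<odot> A) (A \<odot> C)"
    "\<sigma>MA \<in> hom \<C> (M \<odot> A) (A \<odot> M)"
    using CMA.braiding_hom[of 1 1] CMA.braiding_hom[of 3 3] CMA.braiding_hom[of 1 2]
      CMA.braiding_hom[of 1 3] CMA.braiding_hom[of 2 3] by (simp_all add: comps)
  have yb_MAA: "(\<sigma>AA \<otimes> \<one> M) \<cdot> (\<one> A \<otimes> \<sigma>MA) \<cdot> (\<sigma>MA \<otimes> \<one> A) =
      (\<one> A \<otimes> \<sigma>MA) \<cdot> (\<sigma>MA \<otimes> \<one> A) \<cdot> (\<one> M \<otimes> \<sigma>AA)"
    using CMA.yang_baxter[of 2 3 3] by (simp add: comps)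
  have yb_CCM: "(\<sigma>CM \<otimes> \<one> C) \<cdot> (\<one> C \<otimes> \<sigma>CM) \<cdot> (\<sigma>CC \<otimes> \<one> M) =
      (\<one> M \<otimes> \<sigma>CC) \<cdot> (\<sigma>CM \<otimes> \<one> C) \<cdot> (\<one> C \<otimes> \<sigma>CM)"
    using CMA.yang_baxter[of 1 1 2] by (simp add: comps)
  have yb_CMA: "(\<sigma>MA \<otimes> \<one> C) \<cdot> (\<one> M \<otimes> \<sigma>CA) \<cdot> (\<sigma>CM \<otimes> \<one> A) =
      (\<one> A \<otimes> \<sigma>CM) \<cdot> (\<sigma>CA \<otimes> \<one> M) \<cdot> (\<one> C \<otimes> \<sigma>MA)"
    using CMA.yang_baxter[of 1 2 3] by (simp add: comps)
  let ?\<rho>' = "(\<rho> \<otimes> \<one> M) \<cdot> (\<one> N \<otimes> \<sigma>MA)" and ?\<delta>' = "(\<one> N \<otimes> \<sigma>CM) \<cdot> (\<delta> \<otimes> \<one> M)"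
  show ?thesis
  proof unfold_locales
    show "N \<odot> M \<in> obj \<C>"
      by (rule otensor_obj[OF N_obj objs(2)])
    show "?\<rho>' \<in> hom \<C> (N \<odot> M \<odot> A) (N \<odot> M)"
      using action_hom homs(5) N_obj objs by (simp add: hom_def typing)
    show "?\<delta>' \<in> hom \<C> (N \<odot> M) (N \<odot> M \<odot> C)"
      using coaction_hom homs(3) N_obj objs by (simp add: hom_def typing)
    show "?\<rho>' \<cdot> (?\<rho>' \<otimes> \<one> A) = ?\<rho>' \<cdot> (?\<rho>' \<otimes> \<one> A) \<cdot> (\<one> (N \<odot> M) \<otimes> \<sigma>AA)"
      by (rule braided_action_tensor[OF N_obj objs(2,3) action_hom homs(2,5)
            braided_action yb_MAA refl])
    show "(?\<delta>' \<otimes> \<one> C) \<cdot> ?\<delta>' = (\<one> (N \<odot> M) \<otimes> \<sigma>CC) \<cdot> (?\<delta>' \<otimes> \<one> C) \<cdot> ?\<delta>'"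
      by (rule braided_coaction_tensor[OF N_obj objs(2,1) coaction_hom homs(1,3)
            braided_coaction yb_CCM refl])
    show "?\<delta>' \<cdot> ?\<rho>' = (?\<rho>' \<otimes> \<one> C) \<cdot> (\<one> (N \<odot> M) \<otimes> \<sigma>CA) \<cdot> (?\<delta>' \<otimes> \<one> A)"
      by (rule yetter_drinfeld_tensor[OF N_obj objs(2,3,1) action_hom coaction_hom
            homs(3,5,4) yetter_drinfeld yb_CMA refl refl])
  qed
qed

end
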